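(* Let $P$ be a finite irreducible Markov kernel on $V$ with stationary distribution $\pi$, and let $\mathrm{dist}(\mu,\pi)$ be any distance which is convex in $\mu$, i.e. $\mathrm{dist}(\alpha\mu_1+(1-\alpha)\mu_2,\pi)\le \alpha\,\mathrm{dist}(\mu_1,\pi)+(1-\alpha)\,\mathrm{dist}(\mu_2,\pi)$ for all probability distributions $\mu_1,\mu_2$ on $V$ and $\alpha\in[0,1]$. Then for every $x\in V$ and every $n\ge 0$, with $S_0=\{x\}$, $$\mathrm{dist}(P^n(x,\cdot),\pi)\le \hat{\mathbb E}_n\,\mathrm{dist}(\pi_{S_n},\pi).$$
   Context: $P$ is a stochastic matrix on the finite set $V$, irreducible, with stationary distribution $\pi$ ($\pi P=\pi$). For $A,B\subset V$, $Q(A,B)=\sum_{x\in A,y\in B}\pi(x)P(x,y)$ and $Q(A,y)=Q(A,\{y\})$. Evolving set process: from $A\subset V$ choose $u\in[0,1]$ uniformly at random and move to $A_u=\{y\in V: Q(A,y)\ge u\,\pi(y)\}$; its transition kernel on subsets is $K(A,S)=\mathrm{Prob}(A_u=S)$. Its Doob transform is the Markov chain on nonempty subsets with kernel $\hat K(S,S')=\frac{\pi(S')}{\pi(S)}K(S,S')$. $S_0,S_1,S_2,\dots$ denotes the chain with kernel $\hat K$, and $\hat{\mathbb E}_n$ is expectation under $\hat K^n$ started at $S_0$. For nonempty $S\subset V$, $\pi_S(y)=\mathbf 1_S(y)\pi(y)/\pi(S)$. *)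

theory Defs
  imports "HOL-Probability.Probability"
begin

text \<open>
  The finite state space \<open>V\<close> is a type \<open>'v\<close> of class \<open>finite\<close>. Distributions on it are row vectors
  and kernels are matrices, with entry \<open>P $ x $ y\<close> the probability of moving from \<open>x\<close> to \<open>y\<close>.
  Kernels on subsets of \<open>V\<close> are matrices indexed by \<open>'v set\<close>.
\<close>

definition distribution_vec :: "real ^ 'v \<Rightarrow> bool" where
  "distribution_vec \<mu> \<longleftrightarrow> (\<forall>x. 0 \<le> \<mu> $ x) \<and> (\<Sum>x\<in>UNIV. \<mu> $ x) = 1"

definition stochastic :: "real ^ 'v ^ 'v \<Rightarrow> bool" where
  "stochastic P \<longleftrightarrow> (\<forall>x. distribution_vec (P $ x))"

primrec matpow :: "real ^ 'v ^ 'v \<Rightarrow> nat \<Rightarrow> real ^ 'v ^ 'v" where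
  "matpow P 0 = mat 1"
| "matpow P (Suc n) = matpow P n ** P"

definition irreducible_kernel :: "real ^ 'v ^ 'v \<Rightarrow> bool" where
  "irreducible_kernel P \<longleftrightarrow> (\<forall>x y. \<exists>n. 0 < matpow P n $ x $ y)"

definition stationary :: "real ^ 'v ^ 'v \<Rightarrow> real ^ 'v \<Rightarrow> bool" where
  "stationary P \<pi> \<longleftrightarrow> distribution_vec \<pi> \<and> \<pi> v* P = \<pi>"

definition mass :: "real ^ 'v \<Rightarrow> 'v set \<Rightarrow> real" where
  "mass \<pi> A = (\<Sum>x\<in>A. \<pi> $ x)"

definition flow :: "real ^ 'v ^ 'v \<Rightarrow> real ^ 'v \<Rightarrow> 'v set \<Rightarrow> 'v set \<Rightarrow> real" where
  "flow P \<pi> A B = (\<Sum>x\<in>A. \<Sum>y\<in>B. \<pi> $ x * P $ x $ y)"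

definition evolve :: "real ^ 'v ^ 'v \<Rightarrow> real ^ 'v \<Rightarrow> 'v set \<Rightarrow> real \<Rightarrow> 'v set" where
  "evolve P \<pi> A u = {y. flow P \<pi> A {y} \<ge> u * \<pi> $ y}"

definition evolving_set_kernel ::
    "real ^ 'v ^ 'v \<Rightarrow> real ^ 'v \<Rightarrow> real ^ ('v::finite set) ^ ('v set)" where
  "evolving_set_kernel P \<pi> =
     (\<chi> A S. \<P>(u in uniform_measure lborel {0..1}. evolve P \<pi> A u = S))"

text \<open>
  The Doob transform lives on the nonempty subsets. In the matrix below the row and the column of
  the empty set vanish, because \<open>mass \<pi> {} = 0\<close> and \<open>x / 0 = 0\<close>; hence its positive powers, restricted
  to nonempty sets, are those of the kernel on nonempty sets (and this is clear for power 0).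
\<close>

definition doob_kernel ::
    "real ^ 'v ^ 'v \<Rightarrow> real ^ 'v \<Rightarrow> real ^ ('v::finite set) ^ ('v set)" where
  "doob_kernel P \<pi> =
     (\<chi> S S'. mass \<pi> S' / mass \<pi> S * evolving_set_kernel P \<pi> $ S $ S')"

text \<open>Expectation of \<open>f S\<^sub>n\<close> for the Doob transformed chain started at \<open>S\<^sub>0 = S0\<close>.\<close>

definition doob_expectation ::
    "real ^ 'v ^ 'v \<Rightarrow> real ^ 'v \<Rightarrow> nat \<Rightarrow> 'v::finite set \<Rightarrow> ('v set \<Rightarrow> real) \<Rightarrow> real" where
  "doob_expectation P \<pi> n S0 f =
     (\<Sum>S | S \<noteq> {}. matpow (doob_kernel P \<pi>) n $ S0 $ S * f S)"

definition restricted_distribution :: "real ^ 'v \<Rightarrow> 'v set \<Rightarrow> real ^ 'v" where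
  "restricted_distribution \<pi> S = (\<chi> y. indicator S y * \<pi> $ y / mass \<pi> S)"

end

theory Submission
  imports Defs
begin

text \<open>
  By stationarity \<open>Q(A,y) \<le> \<pi>(y)\<close>, so a step of the evolving set process from \<open>A\<close> contains \<open>y\<close> with
  probability exactly \<open>Q(A,y) / \<pi>(y)\<close>. The factor \<open>\<pi>(S) / \<pi>(A)\<close> in the Doob transform \<open>D\<close> of its
  kernel turns this into \<open>\<Sum>\<^sub>S D(A,S) \<pi>\<^sub>S = \<pi>\<^sub>A P\<close>: the map \<open>S \<mapsto> \<pi>\<^sub>S\<close> intertwines the two chains.
  Iterating from \<open>A = {x}\<close> writes \<open>P\<^sup>n(x,\<cdot>)\<close> as the mean of \<open>\<pi>\<^sub>S\<close> over the position \<open>S\<close> of the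
  transformed chain at time \<open>n\<close>, and Jensen's inequality concludes.
\<close>

lemma distribution_vec_mult:
  fixes P :: "real ^ 'v ^ 'v::finite"
  assumes "distribution_vec \<mu>" "stochastic P"
  shows "distribution_vec (\<mu> v* P)"
proof -
  have "(\<Sum>y\<in>UNIV. (\<mu> v* P) $ y) = (\<Sum>x\<in>UNIV. \<mu> $ x * (\<Sum>y\<in>UNIV. P $ x $ y))"
    unfolding vector_matrix_mult_def sum_distrib_left by (subst sum.swap) (simp add: mult.commute)
  then show ?thesis
    using assms
    by (simp add: distribution_vec_def stochastic_def vector_matrix_mult_def sum_nonneg)
qed

lemma distribution_vec_mult_matpow:
  fixes P :: "real ^ 'v ^ 'v::finite"
  assumes "distribution_vec \<mu>" "stochastic P"
  shows "distribution_vec (\<mu> v* matpow P n)"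
  by (induction n)
    (use assms in \<open>simp_all add: distribution_vec_mult flip: vector_matrix_mul_assoc\<close>)

lemma stationary_matpow:
  fixes P :: "real ^ 'v ^ 'v::finite"
  assumes "stationary P \<pi>"
  shows "\<pi> v* matpow P n = \<pi>"
  by (induction n) (use assms in \<open>simp_all add: stationary_def flip: vector_matrix_mul_assoc\<close>)

lemma matpow_nonneg:
  fixes P :: "real ^ 'v ^ 'v::finite"
  assumes "\<And>x y. 0 \<le> P $ x $ y"
  shows "0 \<le> matpow P n $ x $ y"
proof (induction n arbitrary: y)
  case 0
  then show ?case by (simp add: mat_def)
next
  case (Suc n)
  then show ?case by (simp add: matrix_matrix_mult_def sum_nonneg assms)
qed

text \<open>Some state \<open>z\<close> carries mass; irreducibility gives a power of
  \<open>P\<close> leading from \<open>z\<close> to \<open>y\<close>, and invariance of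
  \<open>\<pi>\<close> under that power makes \<open>\<pi> $ y\<close> at least the mass so
  transported. This justifies the later divisions by \<open>\<pi> $ y\<close> and by masses of
  nonempty sets.\<close>

lemma stationary_pos:
  fixes P :: "real ^ 'v ^ 'v::finite"
  assumes "stochastic P" "irreducible_kernel P" "stationary P \<pi>"
  shows "0 < \<pi> $ y"
proof -
  have nonneg: "0 \<le> \<pi> $ z" for z
    using assms(3) by (simp add: stationary_def distribution_vec_def)
  have P: "0 \<le> matpow P n $ z $ w" for n z w
    using assms(1) by (intro matpow_nonneg) (simp add: stochastic_def distribution_vec_def)
  obtain z where z: "\<pi> $ z \<noteq> 0"
    using assms(3) unfolding stationary_def distribution_vec_def
    by (metis sum.neutral zero_neq_one)
  obtain n where n: "0 < matpow P n $ z $ y"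
    using assms(2) by (auto simp: irreducible_kernel_def)
  have "0 < matpow P n $ z $ y * \<pi> $ z"
    using n z nonneg[of z] by simp
  also have "\<dots> \<le> (\<Sum>w\<in>UNIV. matpow P n $ w $ y * \<pi> $ w)"
    by (rule member_le_sum) (simp_all add: P nonneg)
  also have "\<dots> = \<pi> $ y"
    using arg_cong[OF stationary_matpow[OF assms(3), of n], of "\<lambda>v. v $ y"]
    by (simp add: vector_matrix_mult_def mult.commute)
  finally show ?thesis .
qed

text \<open>Enlarging \<open>A\<close> to the whole space only adds nonnegative terms and yields the
  total flow into \<open>y\<close>.\<close>

lemma flow_singleton_le:
  fixes P :: "real ^ 'v ^ 'v::finite"
  assumes "stochastic P" "stationary P \<pi>"
  shows "flow P \<pi> A {y} \<le> \<pi> $ y"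
proof -
  have "flow P \<pi> A {y} \<le> (\<Sum>x\<in>UNIV. \<pi> $ x * P $ x $ y)"
    unfolding flow_def using assms
    by (auto intro!: sum_mono2 simp: stochastic_def stationary_def distribution_vec_def)
  also have "\<dots> = (\<pi> v* P) $ y"
    by (simp add: vector_matrix_mult_def mult.commute)
  finally show ?thesis
    using assms(2) by (simp add: stationary_def)
qed

lemma flow_nonneg:
  fixes P :: "real ^ 'v ^ 'v::finite"
  assumes "stochastic P" "stationary P \<pi>"
  shows "0 \<le> flow P \<pi> A B"
  using assms
  by (auto intro!: sum_nonneg simp: flow_def stochastic_def stationary_def distribution_vec_def)

text \<open>As the state space is finite, the event is a finite Boolean combination of linear
  inequalities in \<open>u\<close>.\<close>

lemma measurable_evolve [measurable]:
  fixes P :: "real ^ 'v ^ 'v::finite"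
  shows "Measurable.pred borel (\<lambda>u. evolve P \<pi> A u = S)"
proof -
  have "(\<lambda>u. evolve P \<pi> A u = S) = (\<lambda>u. \<forall>y. y \<in> S \<longleftrightarrow> u * \<pi> $ y \<le> flow P \<pi> A {y})"
    by (auto simp: evolve_def fun_eq_iff)
  then show ?thesis by simp
qed

text \<open>The left side is the probability that the next set contains \<open>y\<close>, which
  happens exactly when \<open>u\<close> is at most the ratio on the right.\<close>

lemma sum_evolving_set_kernel:
  fixes P :: "real ^ 'v ^ 'v::finite"
  assumes "stochastic P" "irreducible_kernel P" "stationary P \<pi>"
  shows "(\<Sum>S\<in>UNIV. evolving_set_kernel P \<pi> $ A $ S * indicator S y) = flow P \<pi> A {y} / \<pi> $ y"
proof -
  define M where "M = uniform_measure lborel {0..1::real}"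
  interpret prob_space M
    unfolding M_def by (rule prob_space_uniform_measure) auto
  have sets_M [measurable_cong, simp]: "sets M = sets borel" and space_M [simp]: "space M = UNIV"
    by (simp_all add: M_def)
  have pos: "0 < \<pi> $ y" by (rule stationary_pos[OF assms])
  define q where "q = flow P \<pi> A {y} / \<pi> $ y"
  have q: "0 \<le> q" "q \<le> 1"
    using flow_nonneg[OF assms(1,3)] flow_singleton_le[OF assms(1,3)] pos
    by (simp_all add: q_def)
  have "(\<Sum>S\<in>UNIV. evolving_set_kernel P \<pi> $ A $ S * indicator S y)
      = (\<Sum>S | y \<in> S. prob {u. evolve P \<pi> A u = S})"
    by (rule sum.mono_neutral_cong_right) (auto simp: evolving_set_kernel_def M_def)
  also have "\<dots> = prob (\<Union>S\<in>{S. y \<in> S}. {u. evolve P \<pi> A u = S})"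
    by (rule finite_measure_finite_Union[symmetric])
      (auto simp: disjoint_family_on_def)
  also have "(\<Union>S\<in>{S. y \<in> S}. {u. evolve P \<pi> A u = S}) = {u. y \<in> evolve P \<pi> A u}"
    by blast
  \<comment> \<open>Here \<open>u\<close> ranges over all reals, so the event is a half-line; the
    uniform measure then cuts it to \<open>{0..q}\<close>, of length \<open>q\<close> because
    \<open>q\<close> lies in the unit interval.\<close>
  also have "{u. y \<in> evolve P \<pi> A u} = {..q}"
    using pos by (auto simp: evolve_def q_def pos_le_divide_eq)
  also have "prob {..q} = measure lborel ({0..1} \<inter> {..q}) / measure lborel {0..1::real}"
    unfolding M_def by (rule measure_uniform_measure) auto
  also have "{0..1} \<inter> {..q} = {0..q}"
    using q by auto
  finally show ?thesis
    using q by (simp add: q_def)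
qed

lemma mass_pos:
  assumes "\<And>y. 0 < \<pi> $ y" "S \<noteq> {}"
  shows "0 < mass \<pi> (S :: 'v::finite set)"
  using assms by (simp add: mass_def sum_pos)

lemma distribution_vec_restricted_distribution:
  assumes "\<And>y. 0 < \<pi> $ y" "S \<noteq> {}"
  shows "distribution_vec (restricted_distribution \<pi> (S :: 'v::finite set))"
proof -
  have "(\<Sum>y\<in>UNIV. indicator S y * \<pi> $ y) = mass \<pi> S"
    unfolding mass_def by (rule sum.mono_neutral_cong_right) auto
  then show ?thesis
    using mass_pos[OF assms] less_imp_le[OF assms(1)]
    by (auto simp: distribution_vec_def restricted_distribution_def simp flip: sum_divide_distrib)
qed

lemma restricted_distribution_singleton:
  assumes "\<pi> $ x \<noteq> 0"
  shows "restricted_distribution \<pi> {x} = axis x 1"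
  using assms by (auto simp: restricted_distribution_def mass_def axis_def vec_eq_iff)

lemma doob_kernel_nonneg:
  assumes "\<And>y. 0 \<le> \<pi> $ y"
  shows "0 \<le> doob_kernel P \<pi> $ S $ S'"
  using assms by (simp add: doob_kernel_def evolving_set_kernel_def mass_def sum_nonneg)

text \<open>The Doob factor \<open>mass \<pi> S\<close> cancels the normalisation of \<pi>
  restricted to \<open>S\<close>, so only the probability of hitting \<open>y\<close> remains. For
  empty \<open>A\<close> both sides vanish, since \<open>x / 0 = 0\<close>.\<close>

lemma doob_kernel_intertwining:
  fixes P :: "real ^ 'v ^ 'v::finite"
  assumes "stochastic P" "irreducible_kernel P" "stationary P \<pi>"
  shows "(\<Sum>S\<in>UNIV. doob_kernel P \<pi> $ A $ S *\<^sub>R restricted_distribution \<pi> S)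
       = restricted_distribution \<pi> A v* P"
proof (subst vec_eq_iff, intro allI)
  fix y
  note pos = stationary_pos[OF assms]
  have "(\<Sum>S\<in>UNIV. doob_kernel P \<pi> $ A $ S *\<^sub>R restricted_distribution \<pi> S) $ y
      = (\<Sum>S\<in>UNIV. evolving_set_kernel P \<pi> $ A $ S * indicator S y * (\<pi> $ y / mass \<pi> A))"
  proof -
    have "doob_kernel P \<pi> $ A $ S * restricted_distribution \<pi> S $ y
        = evolving_set_kernel P \<pi> $ A $ S * indicator S y * (\<pi> $ y / mass \<pi> A)" for S
    \<comment> \<open>The cancellation needs \<open>S\<close> nonempty, which
      \<open>y \<in> S\<close> ensures; otherwise both sides are zero.\<close>
    proof (cases "y \<in> S")
      case True
      then have "0 < mass \<pi> S"
        using pos by (intro mass_pos) auto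
      then show ?thesis
        by (simp add: doob_kernel_def restricted_distribution_def)
    qed (simp add: restricted_distribution_def)
    then show ?thesis by simp
  qed
  also have "\<dots> = flow P \<pi> A {y} / mass \<pi> A"
    unfolding sum_distrib_right[symmetric] sum_evolving_set_kernel[OF assms]
    using pos[of y] by simp
  also have "\<dots> = (\<Sum>x\<in>UNIV. indicator A x * (\<pi> $ x * P $ x $ y)) / mass \<pi> A"
    unfolding flow_def
    by (intro arg_cong2[where f = "(/)"] refl sum.mono_neutral_cong_left) auto
  also have "\<dots> = (restricted_distribution \<pi> A v* P) $ y"
    by (simp add: vector_matrix_mult_def restricted_distribution_def sum_divide_distrib mult_ac)
  finally show "(\<Sum>S\<in>UNIV. doob_kernel P \<pi> $ A $ S *\<^sub>R restricted_distribution \<pi> S) $ y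
      = (restricted_distribution \<pi> A v* P) $ y" .
qed

lemma matpow_doob_kernel_intertwining:
  fixes P :: "real ^ 'v ^ 'v::finite"
  assumes "stochastic P" "irreducible_kernel P" "stationary P \<pi>"
  shows "(\<Sum>S\<in>UNIV. matpow (doob_kernel P \<pi>) n $ A $ S *\<^sub>R restricted_distribution \<pi> S)
       = restricted_distribution \<pi> A v* matpow P n"
proof (induction n)
  case 0
  have "(\<Sum>S\<in>UNIV. matpow (doob_kernel P \<pi>) 0 $ A $ S *\<^sub>R restricted_distribution \<pi> S)
      = (\<Sum>S\<in>UNIV. if A = S then restricted_distribution \<pi> S else 0)"
    by (intro sum.cong) (auto simp: mat_def)
  then show ?case by simp
next
  case (Suc n)
  let ?D = "doob_kernel P \<pi>" and ?r = "restricted_distribution \<pi>"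
  have "(\<Sum>S\<in>UNIV. matpow ?D (Suc n) $ A $ S *\<^sub>R ?r S)
      = (\<Sum>T\<in>UNIV. matpow ?D n $ A $ T *\<^sub>R (\<Sum>S\<in>UNIV. ?D $ T $ S *\<^sub>R ?r S))"
    unfolding scaleR_sum_right
    by (subst sum.swap) (simp add: matrix_matrix_mult_def scaleR_sum_left)
  \<comment> \<open>The one-step relation rewrites each inner sum, and \<open>P\<close> comes out by
    linearity.\<close>
  also have "\<dots> = (\<Sum>T\<in>UNIV. matpow ?D n $ A $ T *\<^sub>R ?r T) v* P"
    by (simp add: doob_kernel_intertwining[OF assms] vec_eq_iff vector_matrix_mult_def
        sum_distrib_left sum_distrib_right mult_ac) (subst sum.swap, simp add: mult_ac)
  finally show ?case
    by (simp add: Suc vector_matrix_mul_assoc)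
qed

theorem lemma2p2p1:
  fixes P :: "real ^ 'v ^ 'v::finite"
    and \<pi> :: "real ^ 'v"
    and d :: "real ^ 'v \<Rightarrow> real ^ 'v \<Rightarrow> real"
    and x :: 'v
    and n :: nat
  assumes "stochastic P"
    and "irreducible_kernel P"
    and "stationary P \<pi>"
    and "convex_on {\<mu>. distribution_vec \<mu>} (\<lambda>\<mu>. d \<mu> \<pi>)"
  shows "d (matpow P n $ x) \<pi>
           \<le> doob_expectation P \<pi> n {x} (\<lambda>S. d (restricted_distribution \<pi> S) \<pi>)"
proof -
  note pos = stationary_pos[OF assms(1-3)]
  define D where "D S = matpow (doob_kernel P \<pi>) n $ {x} $ S" for S
  let ?r = "restricted_distribution \<pi>"
  \<comment> \<open>Normalising \<pi> on \<open>{x}\<close> gives the point mass at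
    \<open>x\<close>, which selects row \<open>x\<close>.\<close>
  have row: "?r {x} v* matpow P n = matpow P n $ x"
    using pos[of x]
    by (simp add: restricted_distribution_singleton vec_eq_iff vector_matrix_mult_def axis_def
        if_distrib[of "\<lambda>a. a * _"] cong: if_cong)
  \<comment> \<open>The intertwining sums over all sets, the expectation only over nonempty ones;
    the empty set contributes the zero vector.\<close>
  have "?r {} = 0"
    by (simp add: restricted_distribution_def vec_eq_iff)
  then have mean: "(\<Sum>S | S \<noteq> {}. D S *\<^sub>R ?r S) = matpow P n $ x"
    unfolding row[symmetric] matpow_doob_kernel_intertwining[OF assms(1-3), symmetric] D_def
    by (intro sum.mono_neutral_left) auto
  have r: "distribution_vec (?r S)" if "S \<noteq> {}" for S
    using distribution_vec_restricted_distribution[OF pos that] .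
  \<comment> \<open>Summing the coordinates of \<open>mean\<close> shows that no mass is lost to the empty set.\<close>
  have "(\<Sum>S | S \<noteq> {}. D S) = (\<Sum>S | S \<noteq> {}. D S * (\<Sum>y\<in>UNIV. ?r S $ y))"
    using r by (intro sum.cong) (auto simp: distribution_vec_def)
  also have "\<dots> = (\<Sum>y\<in>UNIV. (\<Sum>S | S \<noteq> {}. D S *\<^sub>R ?r S) $ y)"
    unfolding sum_distrib_left by (subst sum.swap) simp
  also have "\<dots> = 1"
    using distribution_vec_mult_matpow[OF r assms(1), of "{x}" n]
    unfolding mean row by (simp add: distribution_vec_def)
  finally have total: "(\<Sum>S | S \<noteq> {}. D S) = 1" .
  \<comment> \<open>Jensen's inequality with weights \<open>D S\<close>; leaving out the empty set
    keeps every point \<open>?r S\<close> in the domain of convexity.\<close>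
  have "d (\<Sum>S | S \<noteq> {}. D S *\<^sub>R ?r S) \<pi> \<le> (\<Sum>S | S \<noteq> {}. D S * d (?r S) \<pi>)"
  proof (rule convex_on_sum[OF _ _ assms(4) total])
    show "{S :: 'v set. S \<noteq> {}} \<noteq> {}" by blast
    show "0 \<le> D S" for S
      unfolding D_def
      by (intro matpow_nonneg doob_kernel_nonneg less_imp_le[OF pos])
  qed (use r in auto)
  then show ?thesis
    unfolding mean by (simp only: doob_expectation_def D_def)
qed

end
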